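(* Let $K,L\subset\mathbb R^n$ be convex bodies satisfying $M(K,L)=|K\cap(-L)|$. Then, for every $\theta\in(0,1)$, $$K+_\theta L\ \subseteq\ \left\{x\in\mathbb R^n:\ |x|\,\left|\frac{d^+}{dt}\left|K\cap\left(t\frac{x}{|x|}-L\right)\right|_{t=0}\right|\ \le\ n(1-\theta^{\frac1n})M(K,L)\right\}.$$
   Context: A convex body in $\mathbb R^n$ is a compact convex set with non-empty interior; $|\cdot|$ denotes Lebesgue measure when applied to sets, the Euclidean norm when applied to vectors, and absolute value when applied to real numbers. $K+L$ is the Minkowski sum, $M(K,L)=\sup_{x\in K+L}|K\cap(x-L)|$, and for $\theta\in[0,1]$, $K+_\theta L=\{x\in K+L:\ |K\cap(x-L)|\ge\theta M(K,L)\}$. $\frac{d^+}{dt}$ denotes the right derivative, evaluated at $t=0$ in the claim. By convention $x=0$ belongs to the right-hand set (the left-hand side of the defining inequality is read as $0$ there). *)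

theory Defs
  imports "HOL-Analysis.Analysis" "HOL-Library.Set_Algebras"
begin

definition convex_body :: "(real ^ 'n) set \<Rightarrow> bool" where
  "convex_body K \<longleftrightarrow> compact K \<and> convex K \<and> interior K \<noteq> {}"

definition conv_vol :: "(real ^ 'n) set \<Rightarrow> (real ^ 'n) set \<Rightarrow> real ^ 'n \<Rightarrow> real" where
  "conv_vol K L x = measure lebesgue (K \<inter> (\<lambda>y. x - y) ` L)"

definition max_conv_vol :: "(real ^ 'n) set \<Rightarrow> (real ^ 'n) set \<Rightarrow> real" where
  "max_conv_vol K L = (SUP x \<in> K + L. conv_vol K L x)"

definition theta_sum :: "real \<Rightarrow> (real ^ 'n) set \<Rightarrow> (real ^ 'n) set \<Rightarrow> (real ^ 'n) set" where
  "theta_sum \<theta> K L = {x \<in> K + L. conv_vol K L x \<ge> \<theta> * max_conv_vol K L}"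

end

theory Submission
  imports Defs
begin

text \<open>
  Brunn-Minkowski makes the \<open>n\<close>-th root of \<open>x \<mapsto> |K \<inter> (x - L)|\<close> concave where it is positive.
  Along the ray through \<open>x\<close> this root is maximal at \<open>0\<close>, so its right derivative there exists, is
  non-positive, and is at least the slope of the chord over \<open>[0, |x|]\<close>; the chain rule for the \<open>n\<close>-th
  power gives the claim. Brunn-Minkowski itself is proved for finite disjoint unions of boxes by the
  Hadwiger-Ohmann cutting argument, an induction on the number of boxes that never changes the
  dimension, and extended to bounded open sets by inner approximation.
\<close>


section \<open>Brunn-Minkowski for two boxes\<close>

text \<open>With \<open>x\<close> and \<open>y\<close> as side lengths this is Brunn-Minkowski for
  two boxes. Divide by the root of the right-hand product: AM-GM bounds each quotient by the mean of
  \<open>x i / (x i + y i)\<close>, respectively \<open>y i / (x i + y i)\<close>, and these ratios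
  add up to 1 for every \<open>i\<close>.\<close>

lemma Minkowski_det_ineq:
  fixes x y :: "'a \<Rightarrow> real"
  assumes fin: "finite S" "S \<noteq> {}"
    and x: "\<And>i. i \<in> S \<Longrightarrow> 0 < x i" and y: "\<And>i. i \<in> S \<Longrightarrow> 0 < y i"
  shows "(root (card S) (\<Prod>i\<in>S. x i) + root (card S) (\<Prod>i\<in>S. y i)) ^ card S \<le> (\<Prod>i\<in>S. x i + y i)"
proof -
  let ?n = "card S" and ?P = "\<Prod>i\<in>S. x i + y i"
  have n: "0 < ?n" using fin by (simp add: card_gt_0_iff)
  have xy: "0 < x i + y i" if "i \<in> S" for i using x[OF that] y[OF that] by simp
  have P: "0 < ?P" using xy by (intro prod_pos) auto
  have am: "root ?n (\<Prod>i\<in>S. z i) \<le> (\<Sum>i\<in>S. z i) / ?n" if "\<And>i. i \<in> S \<Longrightarrow> 0 < z i" for z :: "'a \<Rightarrow> real"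
    using arith_geom_mean[OF fin, of z] that n prod_pos[of S z]
    by (simp add: less_imp_le root_powr_inverse sum_divide_distrib inverse_eq_divide)
  have "root ?n (\<Prod>i\<in>S. x i / (x i + y i)) + root ?n (\<Prod>i\<in>S. y i / (x i + y i))
      \<le> (\<Sum>i\<in>S. x i / (x i + y i)) / ?n + (\<Sum>i\<in>S. y i / (x i + y i)) / ?n"
    by (intro add_mono am divide_pos_pos x y xy)
  also have "\<dots> = (\<Sum>i\<in>S. x i / (x i + y i) + y i / (x i + y i)) / ?n"
    by (simp add: sum.distrib add_divide_distrib)
  also have "(\<Sum>i\<in>S. x i / (x i + y i) + y i / (x i + y i)) = (\<Sum>i\<in>S. 1)"
    using xy by (intro sum.cong refl) (simp add: add_divide_distrib[symmetric] less_imp_neq[symmetric])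
  finally have "root ?n (\<Prod>i\<in>S. x i) / root ?n ?P + root ?n (\<Prod>i\<in>S. y i) / root ?n ?P \<le> 1"
    using n by (simp add: prod_dividef real_root_divide)
  then have "root ?n (\<Prod>i\<in>S. x i) + root ?n (\<Prod>i\<in>S. y i) \<le> root ?n ?P"
    using n P by (simp add: add_divide_distrib[symmetric] divide_le_eq)
  then have "(root ?n (\<Prod>i\<in>S. x i) + root ?n (\<Prod>i\<in>S. y i)) ^ ?n \<le> root ?n ?P ^ ?n"
    using n x y by (intro power_mono add_nonneg_nonneg real_root_ge_zero prod_nonneg) (auto simp: less_imp_le)
  then show ?thesis using n P by simp
qed

lemma bounded_set_plus:
  fixes A B :: "'a::real_normed_vector set"
  assumes "bounded A" "bounded B"
  shows "bounded (A + B)"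
  using bounded_sums[OF assms] by (auto simp: set_plus_def elim!: bounded_subset)

lemma open_set_plus:
  fixes A B :: "'a::real_normed_vector set"
  assumes "open A"
  shows "open (A + B)"
proof -
  have "A + B = (\<Union>x\<in>A. \<Union>y\<in>B. {x + y})" by (auto simp: set_plus_def)
  with open_sums[of A B] assms show ?thesis by simp
qed

text \<open>A point of the big box has a relative position in each coordinate; it is the sum of the
  points with the same relative positions in the two summands.\<close>

lemma box_subset_box_plus_box:
  fixes a b c d :: "'a::euclidean_space"
  assumes "box a b \<noteq> {}" "box c d \<noteq> {}"
  shows "box (a + c) (b + d) \<subseteq> box a b + box c d"
proof
  fix z assume z: "z \<in> box (a + c) (b + d)"
  \<comment> \<open>\<open>t i\<close> is the relative position of \<open>z\<close> in the
    \<open>i\<close>-th edge of the big box, whose length is the sum of the two edge lengths and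
    hence positive.\<close>
  define t where "t i = (z \<bullet> i - a \<bullet> i - c \<bullet> i) / ((b \<bullet> i - a \<bullet> i) + (d \<bullet> i - c \<bullet> i))" for i
  define x where "x = (\<Sum>i\<in>Basis. (a \<bullet> i + t i * (b \<bullet> i - a \<bullet> i)) *\<^sub>R i)"
  have t: "0 < t i \<and> t i < 1 \<and> z \<bullet> i = a \<bullet> i + c \<bullet> i + t i * ((b \<bullet> i - a \<bullet> i) + (d \<bullet> i - c \<bullet> i))"
    and ab: "a \<bullet> i < b \<bullet> i" "c \<bullet> i < d \<bullet> i" if "i \<in> Basis" for i
  proof -
    show *: "a \<bullet> i < b \<bullet> i" "c \<bullet> i < d \<bullet> i" using assms that by (auto simp: box_ne_empty)
    show "0 < t i \<and> t i < 1 \<and> z \<bullet> i = a \<bullet> i + c \<bullet> i + t i * ((b \<bullet> i - a \<bullet> i) + (d \<bullet> i - c \<bullet> i))"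
      using z that * unfolding t_def by (auto simp: mem_box inner_simps)
  qed
  have lt: "p < p + s * (q - p) \<and> p + s * (q - p) < q" if "0 < s" "s < 1" "p < q" for p q s :: real
  proof -
    have "0 < s * (q - p)" "0 < (1 - s) * (q - p)" using that by auto
    then show ?thesis by (auto simp: algebra_simps)
  qed
  have "x \<in> box a b" using t ab lt by (auto simp: x_def mem_box)
  moreover have "z - x \<in> box c d"
  proof -
    have "(z - x) \<bullet> i = c \<bullet> i + t i * (d \<bullet> i - c \<bullet> i)" if "i \<in> Basis" for i
    proof -
      have "x \<bullet> i = a \<bullet> i + t i * (b \<bullet> i - a \<bullet> i)" using that by (simp add: x_def)
      then show ?thesis using t[OF that] by (simp add: inner_diff_left algebra_simps)
    qed
    then show ?thesis using t ab lt by (auto simp: mem_box)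
  qed
  ultimately show "z \<in> box a b + box c d"
    using set_plus_intro[of x "box a b" "z - x" "box c d"] by simp
qed

lemma measure_box_plus_box_ge:
  fixes a b c d :: "'a::euclidean_space"
  assumes ne: "box a b \<noteq> {}" "box c d \<noteq> {}"
  shows "(root DIM('a) (measure lebesgue (box a b)) + root DIM('a) (measure lebesgue (box c d))) ^ DIM('a)
         \<le> measure lebesgue (box a b + box c d)"
proof -
  have ab: "a \<bullet> i < b \<bullet> i" "c \<bullet> i < d \<bullet> i" if "i \<in> Basis" for i
    using ne that by (auto simp: box_ne_empty)
  have m: "measure lebesgue (box p q) = (\<Prod>i\<in>Basis. q \<bullet> i - p \<bullet> i)"
    if "\<And>i. i \<in> Basis \<Longrightarrow> p \<bullet> i < q \<bullet> i" for p q :: 'a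
    using that by (simp add: less_imp_le inner_simps measure_lborel_box)
  have "measure lebesgue (box a b) = (\<Prod>i\<in>Basis. b \<bullet> i - a \<bullet> i)"
    "measure lebesgue (box c d) = (\<Prod>i\<in>Basis. d \<bullet> i - c \<bullet> i)"
    using ab m[of a b] m[of c d] by blast+
  then have "(root DIM('a) (measure lebesgue (box a b)) + root DIM('a) (measure lebesgue (box c d))) ^ DIM('a)
      \<le> (\<Prod>i\<in>Basis. (b \<bullet> i - a \<bullet> i) + (d \<bullet> i - c \<bullet> i))"
    using Minkowski_det_ineq[of "Basis::'a set" "\<lambda>i. b \<bullet> i - a \<bullet> i" "\<lambda>i. d \<bullet> i - c \<bullet> i"] ab
    by simp
  also have "\<dots> = measure lebesgue (box (a + c) (b + d))"
    using ab by (subst m) (auto simp: inner_simps algebra_simps add_strict_mono intro!: prod.cong)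
  also have "\<dots> \<le> measure lebesgue (box a b + box c d)"
    by (intro measure_mono_fmeasurable box_subset_box_plus_box ne lmeasurable_open
        bounded_set_plus open_set_plus bounded_box open_box) auto
  finally show ?thesis .
qed

section \<open>Cutting by coordinate hyperplanes\<close>

lemma box_Int_halfspaces:
  fixes a b :: "'a::euclidean_space"
  assumes "i \<in> Basis"
  shows "\<exists>c d. box a b \<inter> {x. x \<bullet> i < s} = box c d"
    and "\<exists>c d. box a b \<inter> {x. s < x \<bullet> i} = box c d"
proof -
  \<comment> \<open>The added multiple of \<open>i\<close> changes only the \<open>i\<close>-th
    coordinate of the corner \<open>b\<close>, which becomes \<open>min (b \<bullet> i) s\<close>.
    The result may be an empty box.\<close>
  have "box a b \<inter> {x. x \<bullet> i < s} = box a (b + (min (b \<bullet> i) s - b \<bullet> i) *\<^sub>R i)"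
  proof (intro set_eqI)
    fix x
    have "x \<in> box a (b + (min (b \<bullet> i) s - b \<bullet> i) *\<^sub>R i)
        \<longleftrightarrow> (\<forall>j\<in>Basis. a \<bullet> j < x \<bullet> j \<and> x \<bullet> j < (if j = i then min (b \<bullet> i) s else b \<bullet> j))"
      using assms by (auto simp: mem_box inner_simps inner_Basis)
    then show "x \<in> box a b \<inter> {x. x \<bullet> i < s} \<longleftrightarrow> x \<in> box a (b + (min (b \<bullet> i) s - b \<bullet> i) *\<^sub>R i)"
      using assms by (auto simp: mem_box split: if_splits)
  qed
  then show "\<exists>c d. box a b \<inter> {x. x \<bullet> i < s} = box c d" by blast
  have "box a b \<inter> {x. s < x \<bullet> i} = box (a + (max (a \<bullet> i) s - a \<bullet> i) *\<^sub>R i) b"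
  proof (intro set_eqI)
    fix x
    have "x \<in> box (a + (max (a \<bullet> i) s - a \<bullet> i) *\<^sub>R i) b
        \<longleftrightarrow> (\<forall>j\<in>Basis. (if j = i then max (a \<bullet> i) s else a \<bullet> j) < x \<bullet> j \<and> x \<bullet> j < b \<bullet> j)"
      using assms by (auto simp: mem_box inner_simps inner_Basis)
    then show "x \<in> box a b \<inter> {x. s < x \<bullet> i} \<longleftrightarrow> x \<in> box (a + (max (a \<bullet> i) s - a \<bullet> i) *\<^sub>R i) b"
      using assms by (auto simp: mem_box split: if_splits)
  qed
  then show "\<exists>c d. box a b \<inter> {x. s < x \<bullet> i} = box c d" by blast
qed

lemma negligible_coordinate_hyperplane:
  fixes i :: "'a::euclidean_space"
  assumes "i \<in> Basis"
  shows "negligible {x. x \<bullet> i = s}"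
  using negligible_hyperplane[of i s] assms nonzero_Basis by (auto simp: inner_commute)

text \<open>The two open half-spaces miss only the hyperplane itself, which is a null set.\<close>

lemma measure_halfspaces_add:
  fixes U :: "'a::euclidean_space set"
  assumes U: "U \<in> lmeasurable" and i: "i \<in> Basis"
  shows "measure lebesgue (U \<inter> {x. x \<bullet> i < s}) + measure lebesgue (U \<inter> {x. s < x \<bullet> i}) = measure lebesgue U"
proof -
  have b: "{x::'a. x \<bullet> i < s} \<in> sets lebesgue" "{x::'a. s < x \<bullet> i} \<in> sets lebesgue" 
    by (auto intro!: open_Collect_less continuous_intros sets_completionI_sets borel_open)
  have m: "U \<inter> {x. x \<bullet> i < s} \<in> lmeasurable" "U \<inter> {x. s < x \<bullet> i} \<in> lmeasurable"
    using U b by (auto intro: fmeasurable_Int_fmeasurable)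
  have "measure lebesgue (U \<inter> {x. x \<bullet> i < s}) + measure lebesgue (U \<inter> {x. s < x \<bullet> i})
      = measure lebesgue ((U \<inter> {x. x \<bullet> i < s}) \<union> (U \<inter> {x. s < x \<bullet> i}))"
  proof -
    have "(U \<inter> {x. s < x \<bullet> i}) - (U \<inter> {x. x \<bullet> i < s}) = U \<inter> {x. s < x \<bullet> i}" by auto
    then show ?thesis using measure_Un2[OF m] by simp
  qed
  also have "\<dots> = measure lebesgue U"
    by (rule measure_negligible_symdiff)
       (use U m in \<open>auto intro!: negligible_subset[OF negligible_coordinate_hyperplane[OF i, of s]]\<close>)
  finally show ?thesis .
qed

text \<open>Dominated convergence with the indicator of \<open>U\<close> as majorant: if the cuts
  \<open>u n\<close> tend to \<open>s\<close>, the indicators converge at every point off the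
  hyperplane at height \<open>s\<close>.\<close>

lemma continuous_on_measure_halfspace:
  fixes U :: "'a::euclidean_space set"
  assumes U: "U \<in> lmeasurable" and i: "i \<in> Basis"
  shows "continuous_on T (\<lambda>s. measure lebesgue (U \<inter> {x. x \<bullet> i < s}))"
proof (rule continuous_on_sequentiallyI)
  fix u :: "nat \<Rightarrow> real" and s assume u: "u \<longlonglongrightarrow> s"
  have b: "{x::'a. x \<bullet> i < s} \<in> sets lebesgue" for s
    by (auto intro!: open_Collect_less continuous_intros sets_completionI_sets borel_open)
  have m: "U \<inter> {x. x \<bullet> i < s} \<in> lmeasurable" for s
    using U b by (auto intro: fmeasurable_Int_fmeasurable)
  have "(\<lambda>n. LINT x|lebesgue. indicator (U \<inter> {x. x \<bullet> i < u n}) x :: real)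
      \<longlonglongrightarrow> (LINT x|lebesgue. indicator (U \<inter> {x. x \<bullet> i < s}) x)"
  proof (rule integral_dominated_convergence)
    show "integrable lebesgue (indicator U :: 'a \<Rightarrow> real)"
      using U by (auto simp: fmeasurable_def intro!: integrable_real_indicator)
    have "AE x in lebesgue. x \<notin> {x. x \<bullet> i = s}"
      using negligible_coordinate_hyperplane[OF i, of s] by (intro AE_not_in) (simp add: negligible_iff_null_sets)
    then show "AE x in lebesgue. (\<lambda>n. indicator (U \<inter> {x. x \<bullet> i < u n}) x :: real)
        \<longlonglongrightarrow> indicator (U \<inter> {x. x \<bullet> i < s}) x"
    proof eventually_elim
      case (elim x)
      then consider "x \<bullet> i < s" | "s < x \<bullet> i" by fastforce
      \<comment> \<open>Off the hyperplane the strict inequality between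
        \<open>x \<bullet> i\<close> and \<open>s\<close> passes to \<open>u n\<close> for large
        \<open>n\<close>, so the indicators are eventually constant.\<close>
      then have "\<forall>\<^sub>F n in sequentially. (x \<bullet> i < u n) = (x \<bullet> i < s)"
      proof cases
        case 1
        then show ?thesis using order_tendstoD(1)[OF u 1] by (auto elim: eventually_mono)
      next
        case 2
        then show ?thesis using order_tendstoD(2)[OF u 2] by (auto elim!: eventually_mono)
      qed
      then show ?case
        by (intro tendsto_eventually) (auto elim!: eventually_mono simp: indicator_def)
    qed
    show "\<And>n. AE x in lebesgue. norm (indicator (U \<inter> {x. x \<bullet> i < u n}) x :: real) \<le> indicator U x"
      by (auto simp: indicator_def)
  qed (use m in \<open>auto intro!: borel_measurable_indicator fmeasurableD\<close>)
  then show "(\<lambda>n. measure lebesgue (U \<inter> {x. x \<bullet> i < u n})) \<longlonglongrightarrow> measure lebesgue (U \<inter> {x. x \<bullet> i < s})"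
    using m by (simp add: fmeasurableD)
qed

text \<open>Intermediate value theorem: if \<open>U\<close> lies in the ball of radius
  \<open>R\<close>, the cut-off volume is 0 at \<open>-R\<close> and all of \<open>U\<close> at
  \<open>R\<close>.\<close>

lemma exists_halfspace_measure:
  fixes U :: "'a::euclidean_space set"
  assumes U: "U \<in> lmeasurable" "bounded U" and i: "i \<in> Basis" and l: "0 \<le> l" "l \<le> 1"
  obtains s where "measure lebesgue (U \<inter> {x. x \<bullet> i < s}) = l * measure lebesgue U"
proof -
  obtain R where R: "\<And>x. x \<in> U \<Longrightarrow> norm x < R" "0 < R"
    using U(2) by (auto simp: bounded_pos_less)
  have "\<bar>x \<bullet> i\<bar> < R" if "x \<in> U" for x
    using Basis_le_norm[OF i, of x] R(1)[OF that] by simp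
  then have "U \<inter> {x. x \<bullet> i < -R} = {}" "U \<inter> {x. x \<bullet> i < R} = U" by fastforce+
  then have "\<exists>s. -R \<le> s \<and> s \<le> R \<and> measure lebesgue (U \<inter> {x. x \<bullet> i < s}) = l * measure lebesgue U"
    using l R(2) continuous_on_measure_halfspace[OF U(1) i]
    by (intro IVT') (auto simp: mult_left_le_one_le)
  then show thesis using that by blast
qed

section \<open>Finite families of disjoint open boxes\<close>

text \<open>Empty boxes are excluded so that the cardinality counts genuine pieces and a nonempty
  family has a union of positive volume.\<close>

definition disjoint_boxes :: "'a::euclidean_space set set \<Rightarrow> bool" where
  "disjoint_boxes \<D> \<longleftrightarrow> finite \<D> \<and> disjoint \<D> \<and> (\<forall>S\<in>\<D>. S \<noteq> {} \<and> (\<exists>a b. S = box a b))"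

text \<open>Empty traces are discarded, so the number of boxes drops as soon as one box misses
  \<open>H\<close>. This drop drives the induction.\<close>

definition restrict_boxes :: "'a set \<Rightarrow> 'a set set \<Rightarrow> 'a set set" where
  "restrict_boxes H \<D> = (\<lambda>S. S \<inter> H) ` \<D> - {{}}"

lemma Union_restrict_boxes: "\<Union>(restrict_boxes H \<D>) = \<Union>\<D> \<inter> H"
  unfolding restrict_boxes_def by auto

lemma disjoint_boxes_restrict:
  fixes \<D> :: "'a::euclidean_space set set"
  assumes D: "disjoint_boxes \<D>" and i: "i \<in> Basis" and H: "H = {x. x \<bullet> i < s} \<or> H = {x. s < x \<bullet> i}"
  shows "disjoint_boxes (restrict_boxes H \<D>)"
  unfolding disjoint_boxes_def
proof (intro conjI ballI)
  show "finite (restrict_boxes H \<D>)" using D by (simp add: disjoint_boxes_def restrict_boxes_def)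
  have "disjoint \<D>" using D by (simp add: disjoint_boxes_def)
  then show "disjoint (restrict_boxes H \<D>)"
    unfolding disjoint_def restrict_boxes_def by blast
  fix S assume "S \<in> restrict_boxes H \<D>"
  then obtain T where T: "T \<in> \<D>" "S = T \<inter> H" "S \<noteq> {}" unfolding restrict_boxes_def by auto
  then show "S \<noteq> {}" by simp
  obtain a b where "T = box a b" using T D unfolding disjoint_boxes_def by blast
  then show "\<exists>a b. S = box a b" using T H box_Int_halfspaces[OF i] by auto
qed

lemma card_restrict_boxes_le:
  assumes "finite \<D>"
  shows "card (restrict_boxes H \<D>) \<le> card \<D>"
proof -
  have "card (restrict_boxes H \<D>) \<le> card ((\<lambda>S. S \<inter> H) ` \<D>)"
    unfolding restrict_boxes_def using assms by (intro card_mono) auto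
  also have "\<dots> \<le> card \<D>" using assms by (rule card_image_le)
  finally show ?thesis .
qed

lemma card_restrict_boxes_less:
  assumes "finite \<D>" "S \<in> \<D>" "S \<inter> H = {}"
  shows "card (restrict_boxes H \<D>) < card \<D>"
proof -
  have "restrict_boxes H \<D> = restrict_boxes H (\<D> - {S})"
    using assms(3) unfolding restrict_boxes_def by auto
  then have "card (restrict_boxes H \<D>) \<le> card (\<D> - {S})"
    using card_restrict_boxes_le[of "\<D> - {S}" H] assms(1) by simp
  also have "\<dots> < card \<D>" using assms by (intro psubset_card_mono) auto
  finally show ?thesis .
qed

lemma disjoint_boxes_Union:
  assumes "disjoint_boxes \<D>"
  shows "open (\<Union>\<D>)" "bounded (\<Union>\<D>)" "\<Union>\<D> \<in> lmeasurable"
proof -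
  show o: "open (\<Union>\<D>)" using assms unfolding disjoint_boxes_def by (intro open_Union) auto
  show b: "bounded (\<Union>\<D>)" using assms unfolding disjoint_boxes_def by (intro bounded_Union) auto
  show "\<Union>\<D> \<in> lmeasurable" using o b by (rule lmeasurable_open[rotated])
qed

lemma measure_open_pos:
  fixes U :: "'a::euclidean_space set"
  assumes "open U" "bounded U" "U \<noteq> {}"
  shows "0 < measure lebesgue U"
proof -
  have "U \<in> lmeasurable" using assms by (simp add: lmeasurable_open)
  then show ?thesis
    using open_not_negligible[of U] assms negligible_iff_measure[of U]
    by (metis measure_nonneg order_le_less)
qed

section \<open>Hadwiger-Ohmann induction\<close>

text \<open>Two disjoint nonempty boxes have disjoint projections on some axis. The right end of the
  projection lying to the left serves as \<open>s\<close>; as boxes are open, both inclusions are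
  strict.\<close>

lemma separate_disjoint_boxes:
  fixes \<D> :: "'a::euclidean_space set set"
  assumes D: "disjoint_boxes \<D>" and card: "1 < card \<D>"
  obtains S T i s where "S \<in> \<D>" "T \<in> \<D>" "i \<in> Basis" "S \<subseteq> {x. x \<bullet> i < s}" "T \<subseteq> {x. s < x \<bullet> i}"
proof -
  obtain S T where ST: "S \<in> \<D>" "T \<in> \<D>" "S \<noteq> T"
  proof -
    have "finite \<D>" "\<not> card \<D> \<le> Suc 0" using D card by (auto simp: disjoint_boxes_def)
    then show thesis using that card_le_Suc0_iff_eq by blast
  qed
  have dis: "S \<inter> T = {}" using D ST unfolding disjoint_boxes_def disjoint_def by blast
  obtain a b c d where *: "S = box a b" "T = box c d" "box a b \<noteq> {}" "box c d \<noteq> {}"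
    using D ST unfolding disjoint_boxes_def by metis
  \<comment> \<open>The first two alternatives say that one of the boxes is empty, which is ruled
    out next.\<close>
  have "\<exists>i\<in>Basis. b \<bullet> i \<le> a \<bullet> i \<or> d \<bullet> i \<le> c \<bullet> i \<or> b \<bullet> i \<le> c \<bullet> i \<or> d \<bullet> i \<le> a \<bullet> i"
    using dis * disjoint_interval(4)[of a b c d] by simp
  then obtain i where i: "i \<in> Basis" "b \<bullet> i \<le> c \<bullet> i \<or> d \<bullet> i \<le> a \<bullet> i"
    using * by (metis box_ne_empty(2) not_le)
  from i(2) show thesis
  proof
    assume "b \<bullet> i \<le> c \<bullet> i"
    then show thesis using that[OF ST(1,2) i(1), of "b \<bullet> i"] * i(1) by (fastforce simp: mem_box)
  next
    assume "d \<bullet> i \<le> a \<bullet> i"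
    then show thesis using that[OF ST(2,1) i(1), of "d \<bullet> i"] * i(1) by (fastforce simp: mem_box)
  qed
qed

text \<open>The hyperplane separates two boxes of the first family, so both of its halves have fewer boxes;
  the second family is cut in the same volume ratio, and the two partial sums are disjoint.\<close>

lemma Brunn_Minkowski_boxes_step:
  fixes \<D> \<E> :: "'a::euclidean_space set set"
  assumes D: "disjoint_boxes \<D>" "1 < card \<D>" and E: "disjoint_boxes \<E>" "\<E> \<noteq> {}"
    and IH: "\<And>\<D>' \<E>' :: 'a set set. \<lbrakk>disjoint_boxes \<D>'; disjoint_boxes \<E>'; \<D>' \<noteq> {}; \<E>' \<noteq> {}; card \<D>' + card \<E>' < card \<D> + card \<E>\<rbrakk> \<Longrightarrow>
      (root DIM('a) (measure lebesgue (\<Union>\<D>')) + root DIM('a) (measure lebesgue (\<Union>\<E>'))) ^ DIM('a)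
        \<le> measure lebesgue (\<Union>\<D>' + \<Union>\<E>')"
  shows "(root DIM('a) (measure lebesgue (\<Union>\<D>)) + root DIM('a) (measure lebesgue (\<Union>\<E>))) ^ DIM('a)
        \<le> measure lebesgue (\<Union>\<D> + \<Union>\<E>)"
proof -
  define A where "A = \<Union>\<D>"
  define B where "B = \<Union>\<E>"
  let ?v = "measure lebesgue :: 'a set \<Rightarrow> real"
  let ?n = "DIM('a)"
  note A = disjoint_boxes_Union[OF D(1), folded A_def] and B = disjoint_boxes_Union[OF E(1), folded B_def]
  have fin: "finite \<D>" "finite \<E>" using D E unfolding disjoint_boxes_def by auto
  obtain S T i s where S: "S \<in> \<D>" "T \<in> \<D>" "i \<in> Basis" "S \<subseteq> {x. x \<bullet> i < s}" "T \<subseteq> {x. s < x \<bullet> i}"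
    using separate_disjoint_boxes[OF D] .
  have ST: "S \<noteq> {}" "T \<noteq> {}" using D(1) S unfolding disjoint_boxes_def by auto
  define l where "l = ?v (A \<inter> {x. x \<bullet> i < s}) / ?v A"
  have opn: "open {x::'a. x \<bullet> i < s}" "open {x::'a. s < x \<bullet> i}" for s
    by (auto intro!: open_Collect_less continuous_intros)
  have A1: "A \<inter> {x. x \<bullet> i < s} \<noteq> {}" "A \<inter> {x. s < x \<bullet> i} \<noteq> {}" using S ST A_def by auto
  have pos1: "0 < ?v (A \<inter> {x. x \<bullet> i < s})" "0 < ?v (A \<inter> {x. s < x \<bullet> i})"
    using A A1 by (intro measure_open_pos open_Int opn bounded_Int disjI1; simp)+
  have sumA: "?v (A \<inter> {x. x \<bullet> i < s}) + ?v (A \<inter> {x. s < x \<bullet> i}) = ?v A"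
    using A(3) S(3) by (rule measure_halfspaces_add)
  have posA: "0 < ?v A" using pos1 sumA by linarith
  have l: "0 < l" "l < 1" using pos1 sumA posA by (auto simp: l_def)
  have lA: "?v (A \<inter> {x. x \<bullet> i < s}) = l * ?v A" "?v (A \<inter> {x. s < x \<bullet> i}) = (1 - l) * ?v A"
  proof -
    show *: "?v (A \<inter> {x. x \<bullet> i < s}) = l * ?v A" using posA by (simp add: l_def)
    show "?v (A \<inter> {x. s < x \<bullet> i}) = (1 - l) * ?v A" using sumA unfolding * by (simp add: algebra_simps)
  qed
  \<comment> \<open>The second family is cut by a parallel hyperplane at the height \<open>r\<close>
    where the volume ratio \<open>l\<close> is the same as for the first.\<close>
  obtain r where r: "?v (B \<inter> {x. x \<bullet> i < r}) = l * ?v B"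
    using exists_halfspace_measure[OF B(3,2) S(3)] l by (metis less_imp_le)
  have lB: "?v (B \<inter> {x. r < x \<bullet> i}) = (1 - l) * ?v B"
    using measure_halfspaces_add[OF B(3) S(3), of r] r by (simp add: algebra_simps)
  have "B \<noteq> {}" using E unfolding B_def disjoint_boxes_def by auto
  then have posB: "0 < ?v B" using B by (intro measure_open_pos)
  \<comment> \<open>Both pairs of halves are treated at once, with \<open>m\<close> being
    \<open>l\<close> or \<open>1 - l\<close>. Equal ratios let \<open>root ?n m\<close> be factored
    out of both roots, and its \<open>?n\<close>-th power is \<open>m\<close>.\<close>
  have ineq: "m * (root ?n (?v A) + root ?n (?v B)) ^ ?n \<le> ?v ((A \<inter> H) + (B \<inter> H'))"
    if H: "(H = {x. x \<bullet> i < s} \<and> H' = {x. x \<bullet> i < r}) \<or> (H = {x. s < x \<bullet> i} \<and> H' = {x. r < x \<bullet> i})"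
      and m: "?v (A \<inter> H) = m * ?v A" "?v (B \<inter> H') = m * ?v B" "0 < m" for H H' m
  proof -
    have "0 < ?v (A \<inter> H)" "0 < ?v (B \<inter> H')" using m posA posB by auto
    then have ne: "restrict_boxes H \<D> \<noteq> {}" "restrict_boxes H' \<E> \<noteq> {}"
      using Union_restrict_boxes[of H \<D>] Union_restrict_boxes[of H' \<E>] by (auto simp: A_def B_def)
    have "card (restrict_boxes H \<D>) < card \<D>"
    proof (rule disjE[OF H])
      assume "H = {x. x \<bullet> i < s} \<and> H' = {x. x \<bullet> i < r}"
      \<comment> \<open>The lower half loses \<open>T\<close>, the upper half loses
        \<open>S\<close>; cutting the second family cannot increase its number of boxes.\<close>
      then have "T \<inter> H = {}" using S(5) by fastforce
      then show ?thesis using card_restrict_boxes_less[OF fin(1) S(2)] by blast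
    next
      assume "H = {x. s < x \<bullet> i} \<and> H' = {x. r < x \<bullet> i}"
      then have "S \<inter> H = {}" using S(4) by fastforce
      then show ?thesis using card_restrict_boxes_less[OF fin(1) S(1)] by blast
    qed
    then have "card (restrict_boxes H \<D>) + card (restrict_boxes H' \<E>) < card \<D> + card \<E>"
      using card_restrict_boxes_le[OF fin(2), of H'] by linarith
    moreover have "disjoint_boxes (restrict_boxes H \<D>)"
      using H by (intro disjoint_boxes_restrict[OF D(1) S(3), of H s]) blast
    moreover have "disjoint_boxes (restrict_boxes H' \<E>)"
      using H by (intro disjoint_boxes_restrict[OF E(1) S(3), of H' r]) blast
    ultimately have "(root ?n (?v (A \<inter> H)) + root ?n (?v (B \<inter> H'))) ^ ?n \<le> ?v ((A \<inter> H) + (B \<inter> H'))"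
      using IH[of "restrict_boxes H \<D>" "restrict_boxes H' \<E>"] ne
      unfolding Union_restrict_boxes A_def B_def by blast
    then have "(root ?n (m * ?v A) + root ?n (m * ?v B)) ^ ?n \<le> ?v ((A \<inter> H) + (B \<inter> H'))"
      unfolding m(1,2) .
    moreover have "(root ?n (m * ?v A) + root ?n (m * ?v B)) ^ ?n = (root ?n m * (root ?n (?v A) + root ?n (?v B))) ^ ?n"
      by (simp add: real_root_mult distrib_left)
    ultimately show ?thesis using m(3) by (simp add: power_mult_distrib)
  qed
  let ?P = "(A \<inter> {x. x \<bullet> i < s}) + (B \<inter> {x. x \<bullet> i < r})" and ?Q = "(A \<inter> {x. s < x \<bullet> i}) + (B \<inter> {x. r < x \<bullet> i})"
  have lm: "?P \<in> lmeasurable" "?Q \<in> lmeasurable" "A + B \<in> lmeasurable"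
    using A B by (auto intro!: lmeasurable_open bounded_set_plus open_set_plus bounded_Int open_Int opn)
  \<comment> \<open>Sums of lower halves lie strictly below height \<open>s + r\<close>, sums of
    upper halves strictly above it.\<close>
  have disj: "?P \<inter> ?Q = {}"
  proof -
    have "?P \<subseteq> {x. x \<bullet> i < s + r}" "?Q \<subseteq> {x. s + r < x \<bullet> i}"
      by (auto simp: set_plus_def inner_add_left intro: add_strict_mono)
    then show ?thesis by fastforce
  qed
  have "(root ?n (?v A) + root ?n (?v B)) ^ ?n = l * (root ?n (?v A) + root ?n (?v B)) ^ ?n + (1 - l) * (root ?n (?v A) + root ?n (?v B)) ^ ?n"
    by (simp add: algebra_simps)
  also have "\<dots> \<le> ?v ?P + ?v ?Q"
    using l lA r lB by (intro add_mono ineq) auto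
  also have "\<dots> = ?v (?P \<union> ?Q)"
    using measure_Un2[OF lm(1,2)] disj by (metis Diff_triv inf_commute)
  also have "\<dots> \<le> ?v (A + B)"
    using lm by (intro measure_mono_fmeasurable) (auto simp: set_plus_def)
  finally show ?thesis by (simp add: A_def B_def)
qed

text \<open>Induction on the total number of boxes. If either family has at least two, the cutting
  step applies, with the roles exchanged if necessary; two single boxes are the base case.\<close>

lemma Brunn_Minkowski_boxes:
  fixes \<D> \<E> :: "'a::euclidean_space set set"
  assumes "disjoint_boxes \<D>" "disjoint_boxes \<E>" "\<D> \<noteq> {}" "\<E> \<noteq> {}"
  shows "(root DIM('a) (measure lebesgue (\<Union>\<D>)) + root DIM('a) (measure lebesgue (\<Union>\<E>))) ^ DIM('a)
        \<le> measure lebesgue (\<Union>\<D> + \<Union>\<E>)"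
  using assms
proof (induction "card \<D> + card \<E>" arbitrary: \<D> \<E> rule: less_induct)
  case less
  have c: "0 < card \<D>" "0 < card \<E>"
    using less.prems by (auto simp: disjoint_boxes_def card_gt_0_iff)
  consider "1 < card \<D>" | "1 < card \<E>" | "card \<D> = 1" "card \<E> = 1" using c by linarith
  then show ?case
  proof cases
    case 1
    show ?thesis
    proof (rule Brunn_Minkowski_boxes_step[OF less.prems(1) 1 less.prems(2,4)])
      fix \<D>' \<E>' :: "'a set set"
      assume "disjoint_boxes \<D>'" "disjoint_boxes \<E>'" "\<D>' \<noteq> {}" "\<E>' \<noteq> {}" "card \<D>' + card \<E>' < card \<D> + card \<E>"
      then show "(root DIM('a) (measure lebesgue (\<Union>\<D>')) + root DIM('a) (measure lebesgue (\<Union>\<E>'))) ^ DIM('a)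
        \<le> measure lebesgue (\<Union>\<D>' + \<Union>\<E>')"
        by (intro less.hyps)
    qed
  next
    case 2
    have "(root DIM('a) (measure lebesgue (\<Union>\<E>)) + root DIM('a) (measure lebesgue (\<Union>\<D>))) ^ DIM('a)
        \<le> measure lebesgue (\<Union>\<E> + \<Union>\<D>)"
    proof (rule Brunn_Minkowski_boxes_step[OF less.prems(2) 2 less.prems(1,3)])
      fix \<D>' \<E>' :: "'a set set"
      assume "disjoint_boxes \<D>'" "disjoint_boxes \<E>'" "\<D>' \<noteq> {}" "\<E>' \<noteq> {}" "card \<D>' + card \<E>' < card \<E> + card \<D>"
      then show "(root DIM('a) (measure lebesgue (\<Union>\<D>')) + root DIM('a) (measure lebesgue (\<Union>\<E>'))) ^ DIM('a)
        \<le> measure lebesgue (\<Union>\<D>' + \<Union>\<E>')"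
        by (intro less.hyps) (auto simp: add.commute)
    qed
    then show ?thesis by (simp only: add.commute)
  next
    case 3
    then obtain S T where ST: "\<D> = {S}" "\<E> = {T}" by (meson card_1_singletonE)
    have "\<exists>a b. S = box a b" "\<exists>c d. T = box c d" and ne: "S \<noteq> {}" "T \<noteq> {}"
      using less.prems(1,2) by (simp_all add: disjoint_boxes_def ST)
    then obtain a b c d where "S = box a b" "T = box c d" by metis
    then show ?thesis using measure_box_plus_box_ge[of a b c d] ne by (simp add: ST)
  qed
qed

section \<open>Inner approximation of open sets\<close>

text \<open>An open set is a countable union of closed boxes, and finite subunions exhaust its
  volume. Such a subunion is divided into non-overlapping closed boxes, and passing to their
  interiors loses only a null set.\<close>

lemma open_approx_disjoint_boxes:
  fixes U :: "'a::euclidean_space set"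
  assumes U: "open U" "bounded U" and e: "0 < e"
  obtains \<D> where "disjoint_boxes \<D>" "\<Union>\<D> \<subseteq> U" "measure lebesgue U - e < measure lebesgue (\<Union>\<D>)"
proof -
  obtain \<C> where C: "countable \<C>" "\<And>X. X \<in> \<C> \<Longrightarrow> \<exists>a b. X = cbox a b" "\<Union>\<C> = U"
    using open_countable_Union_open_cbox[OF U(1)] by metis
  \<comment> \<open>Inserting the empty set ensures that there is something to enumerate even if
    \<open>\<C>\<close> is empty; the next fact but one writes it as a closed box.\<close>
  define c where "c = from_nat_into (insert {} \<C>)"
  define F where "F n = \<Union>(c ` {..n})" for n
  have rc: "range c = insert {} \<C>"
    unfolding c_def using C(1) by (intro range_from_nat_into) auto
  have "cbox One (- One :: 'a) = {}"
    unfolding box_eq_empty using SOME_Basis by (intro bexI[of _ "SOME i. i \<in> Basis"]) simp_all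
  then have cb: "\<exists>a b. c n = cbox a b" for n
    using C(2) rc by (metis insertE rangeI)
  have UF: "(\<Union>n. F n) = U" using C(3) rc by (auto simp: F_def) blast+
  have "F n \<in> sets lebesgue" for n
    unfolding F_def using cb by (intro sets.finite_UN) (auto, metis lmeasurable_cbox fmeasurableD)
  then have "(\<lambda>n. measure lebesgue (F n)) \<longlonglongrightarrow> measure lebesgue (\<Union>n. F n)"
  proof (intro Lim_measure_incseq)
    show "incseq F" unfolding F_def by (intro monoI Union_mono image_mono) auto
    show "emeasure lebesgue (\<Union>n. F n) \<noteq> \<infinity>"
      unfolding UF using fmeasurableD2[OF lmeasurable_open[OF U(2,1)]] by (simp del: emeasure_completion)
  qed blast
  then have "\<forall>\<^sub>F n in sequentially. measure lebesgue U - e < measure lebesgue (F n)"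
    using e by (intro order_tendstoD) (auto simp: UF)
  then obtain n where n: "measure lebesgue U - e < measure lebesgue (F n)"
    by (auto simp: eventually_sequentially)
  obtain p where p: "p division_of (F n)"
    unfolding F_def
  proof (rule elementary_unions_intervals)
    show "\<exists>a b. S = cbox a b" if "S \<in> c ` {..n}" for S using that cb by auto
  qed auto
  \<comment> \<open>Members of a division may be degenerate, so their interiors can be empty and
    have to be removed.\<close>
  define \<D> where "\<D> = interior ` p - {{}}"
  have D: "disjoint_boxes \<D>"
    unfolding disjoint_boxes_def
  proof (intro conjI ballI)
    show "finite \<D>" using p by (auto simp: \<D>_def)
    show "disjoint \<D>" using division_ofD(5)[OF p] unfolding \<D>_def disjoint_def by blast
    fix S assume "S \<in> \<D>"
    then obtain X where X: "X \<in> p" "S = interior X" "S \<noteq> {}" by (auto simp: \<D>_def)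
    then show "S \<noteq> {}" by simp
    obtain a b where "X = cbox a b" using division_ofD(4)[OF p X(1)] by blast
    then show "\<exists>a b. S = box a b" using X(2) interior_cbox by blast
  qed
  let ?N = "\<Union>X\<in>p. X - interior X"
  have neg: "negligible ?N"
  proof (intro negligible_Union)
    show "finite ((\<lambda>X. X - interior X) ` p)" using p by auto
    fix N assume "N \<in> (\<lambda>X. X - interior X) ` p"
    then obtain X where X: "X \<in> p" "N = X - interior X" by blast
    obtain a b where "X = cbox a b" using division_ofD(4)[OF p X(1)] by blast
    then show "negligible N" using X by (simp add: interior_cbox negligible_frontier_interval)
  qed
  have "measure lebesgue (F n) \<le> measure lebesgue (\<Union>\<D> \<union> ?N)"
  proof (rule measure_mono_fmeasurable)
    have "x \<in> \<Union>\<D> \<union> ?N" if "x \<in> X" "X \<in> p" for x X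
      using that unfolding \<D>_def by (cases "x \<in> interior X") blast+
    then show "F n \<subseteq> \<Union>\<D> \<union> ?N" unfolding division_ofD(6)[OF p, symmetric] by blast
    show "F n \<in> sets lebesgue" by fact
    show "\<Union>\<D> \<union> ?N \<in> lmeasurable"
      using disjoint_boxes_Union(3)[OF D] negligible_imp_measurable[OF neg] by (rule fmeasurable.Un)
  qed
  also have "\<dots> = measure lebesgue (\<Union>\<D>)"
    using disjoint_boxes_Union(3)[OF D] neg
    by (intro measure_Un_null_set) (auto simp: negligible_iff_null_sets fmeasurableD)
  finally have "measure lebesgue U - e < measure lebesgue (\<Union>\<D>)" using n by simp
  moreover have "\<Union>\<D> \<subseteq> U"
    using division_ofD(6)[OF p] UF interior_subset unfolding \<D>_def by blast
  ultimately show thesis using that D by blast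
qed

lemma Brunn_Minkowski_open:
  fixes A B :: "'a::euclidean_space set"
  assumes A: "open A" "bounded A" "A \<noteq> {}" and B: "open B" "bounded B" "B \<noteq> {}"
  shows "(root DIM('a) (measure lebesgue A) + root DIM('a) (measure lebesgue B)) ^ DIM('a)
         \<le> measure lebesgue (A + B)"
proof -
  let ?v = "measure lebesgue :: 'a set \<Rightarrow> real" and ?n = "DIM('a)"
  have pos: "0 < ?v A" "0 < ?v B" using measure_open_pos A B by blast+
  have AB: "A + B \<in> lmeasurable" using A B by (intro lmeasurable_open open_set_plus bounded_set_plus)
  \<comment> \<open>Taking \<open>e\<close> below both volumes keeps \<open>?v A - e\<close> and
    \<open>?v B - e\<close> positive, so the approximating families are nonempty and the power is
    monotone. Letting \<open>e\<close> tend to 0 then finishes the proof.\<close>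
  have le: "(root ?n (?v A - e) + root ?n (?v B - e)) ^ ?n \<le> ?v (A + B)" if e: "0 < e" "e < min (?v A) (?v B)" for e
  proof -
    obtain \<D> where D: "disjoint_boxes \<D>" "\<Union>\<D> \<subseteq> A" "?v A - e < ?v (\<Union>\<D>)"
      using open_approx_disjoint_boxes[OF A(1,2) e(1)] .
    obtain \<E> where E: "disjoint_boxes \<E>" "\<Union>\<E> \<subseteq> B" "?v B - e < ?v (\<Union>\<E>)"
      using open_approx_disjoint_boxes[OF B(1,2) e(1)] .
    have "\<D> \<noteq> {}" "\<E> \<noteq> {}" using D(3) E(3) e by auto
    have "(root ?n (?v A - e) + root ?n (?v B - e)) ^ ?n \<le> (root ?n (?v (\<Union>\<D>)) + root ?n (?v (\<Union>\<E>))) ^ ?n"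
      using D(3) E(3) e by (intro power_mono add_mono add_nonneg_nonneg) (auto simp: real_root_le_iff)
    also have "\<dots> \<le> ?v (\<Union>\<D> + \<Union>\<E>)"
      by (intro Brunn_Minkowski_boxes D E \<open>\<D> \<noteq> {}\<close> \<open>\<E> \<noteq> {}\<close>)
    also have "\<dots> \<le> ?v (A + B)"
    proof (rule measure_mono_fmeasurable[OF set_plus_mono2[OF D(2) E(2)] _ AB])
      show "\<Union>\<D> + \<Union>\<E> \<in> sets lebesgue"
        using disjoint_boxes_Union[OF D(1)] disjoint_boxes_Union[OF E(1)]
        by (intro fmeasurableD lmeasurable_open open_set_plus bounded_set_plus)
    qed
    finally show ?thesis .
  qed
  have "((\<lambda>e. (root ?n (?v A - e) + root ?n (?v B - e)) ^ ?n) \<longlongrightarrow> (root ?n (?v A - 0) + root ?n (?v B - 0)) ^ ?n) (at_right 0)"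
    by (intro tendsto_intros)
  moreover have "\<forall>\<^sub>F e in at_right 0. (root ?n (?v A - e) + root ?n (?v B - e)) ^ ?n \<le> ?v (A + B)"
    using le pos by (intro eventually_at_rightI[of 0 "min (?v A) (?v B)"]) auto
  ultimately have "(root ?n (?v A - 0) + root ?n (?v B - 0)) ^ ?n \<le> ?v (A + B)"
    by (intro tendsto_upperbound) auto
  then show ?thesis by (simp del: measure_completion)
qed

section \<open>Brunn-Minkowski for convex sets\<close>

lemma measure_interior_convex:
  fixes S :: "'a::euclidean_space set"
  assumes "convex S" "bounded S"
  shows "measure lebesgue (interior S) = measure lebesgue S"
proof (rule measure_negligible_symdiff)
  show "negligible (S - interior S \<union> (interior S - S))"
    using negligible_convex_frontier[OF assms(1)] closure_subset[of S] interior_subset[of S]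
    by (elim negligible_subset) (auto simp: frontier_def)
qed (use assms in \<open>auto intro: lmeasurable_interior measurable_convex\<close>)

text \<open>The open version is applied to the interiors scaled by \<open>1 - t\<close> and
  \<open>t\<close>: a convex set has a null frontier, so interiors keep the volume, and the root of
  the volume scales linearly. The sum of the scaled interiors lies in \<open>Z\<close>.\<close>

lemma Brunn_Minkowski_convex:
  fixes S T Z :: "'a::euclidean_space set"
  assumes S: "convex S" "bounded S" "0 < measure lebesgue S"
    and T: "convex T" "bounded T" "0 < measure lebesgue T"
    and t: "0 < t" "t < 1" and Z: "Z \<in> lmeasurable"
    and sub: "\<And>x y. x \<in> S \<Longrightarrow> y \<in> T \<Longrightarrow> (1 - t) *\<^sub>R x + t *\<^sub>R y \<in> Z"
  shows "(1 - t) * root DIM('a) (measure lebesgue S) + t * root DIM('a) (measure lebesgue T)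
         \<le> root DIM('a) (measure lebesgue Z)"
proof -
  let ?v = "measure lebesgue :: 'a set \<Rightarrow> real" and ?n = "DIM('a)"
  define A where "A = (\<lambda>x. (1 - t) *\<^sub>R x) ` interior S"
  define B where "B = (\<lambda>x. t *\<^sub>R x) ` interior T"
  have ne: "interior S \<noteq> {}" "interior T \<noteq> {}"
    using S T measure_interior_convex by force+
  have A: "open A" "bounded A" "A \<noteq> {}" and B: "open B" "bounded B" "B \<noteq> {}"
    using t ne S T by (auto simp: A_def B_def intro!: open_scaling bounded_scaling bounded_interior)
  have sc: "?v ((\<lambda>x. c *\<^sub>R x) ` X) = c ^ ?n * ?v X" if "0 < c" for c and X :: "'a set"
    using measure_lebesgue_affine[of c 0 X] that by (simp del: measure_completion)
  have "root ?n (?v A) = (1 - t) * root ?n (?v S)" "root ?n (?v B) = t * root ?n (?v T)"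
    using t S T unfolding A_def B_def
    by (simp_all add: sc measure_interior_convex real_root_mult real_root_power_cancel del: measure_completion)
  then have "((1 - t) * root ?n (?v S) + t * root ?n (?v T)) ^ ?n \<le> ?v (A + B)"
    using Brunn_Minkowski_open[OF A B] by simp
  also have "\<dots> \<le> ?v Z"
  proof (rule measure_mono_fmeasurable)
    show "A + B \<subseteq> Z"
      using sub interior_subset[of S] interior_subset[of T] by (auto simp: A_def B_def set_plus_def subset_iff)
    show "A + B \<in> sets lebesgue"
      using A B by (intro fmeasurableD lmeasurable_open open_set_plus bounded_set_plus)
  qed (rule Z)
  finally have "root ?n (((1 - t) * root ?n (?v S) + t * root ?n (?v T)) ^ ?n) \<le> root ?n (?v Z)"
    by (simp add: real_root_le_mono)
  then show ?thesis
    using t by (subst (asm) real_root_power_cancel) auto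
qed

section \<open>Right derivative at a maximum\<close>

text \<open>Concavity along chords starting at 0 makes the descent quotient \<open>q\<close>
  monotone, and maximality at 0 makes it nonnegative. Hence \<open>q\<close> tends to its infimum
  from the right, and the infimum lies between 0 and \<open>q r\<close>.\<close>

lemma concave_right_derivative:
  fixes G :: "real \<Rightarrow> real"
  assumes r: "0 < r"
    and conc: "\<And>a b. 0 < a \<Longrightarrow> a < b \<Longrightarrow> b \<le> r \<Longrightarrow> (1 - a / b) * G 0 + a / b * G b \<le> G a"
    and max: "\<And>t. 0 < t \<Longrightarrow> t \<le> r \<Longrightarrow> G t \<le> G 0"
  obtains D where "(G has_real_derivative D) (at_right 0)" "r * \<bar>D\<bar> \<le> G 0 - G r"
proof -
  define q where "q t = (G 0 - G t) / t" for t
  define L where "L = Inf (q ` ({0<..} \<inter> {..r}))"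
  have q0: "0 \<le> q a" if "a \<in> {..r}" "0 < a" for a using max that by (simp add: q_def)
  have mono: "q a \<le> q b" if "a \<in> {..r}" "b \<in> {..r}" "0 < a" "a \<le> b" for a b
  proof (cases "a = b")
    case False
    then have "G 0 - G a \<le> a / b * (G 0 - G b)"
      using conc[of a b] that by (simp add: algebra_simps)
    then show ?thesis using that by (simp add: q_def field_simps)
  qed auto
  have "(q \<longlongrightarrow> L) (at 0 within ({0<..} \<inter> {..r}))"
    unfolding L_def using mono q0 by (rule Lim_right_bound)
  moreover have "at 0 within ({0<..} \<inter> {..r}) = at_right 0"
    using r by (intro at_within_nhd[of 0 "{..<r}"]) auto
  ultimately have "((\<lambda>t. - q t) \<longlongrightarrow> - L) (at_right 0)" by (auto intro: tendsto_minus)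
  then have D: "(G has_real_derivative - L) (at_right 0)"
    by (simp add: has_field_derivative_iff q_def minus_divide_left)
  have "0 \<le> L" unfolding L_def using r q0 by (intro cInf_greatest) auto
  moreover have "L \<le> q r"
    unfolding L_def using r q0 by (intro cInf_lower bdd_belowI[of _ 0]) auto
  then have "r * L \<le> G 0 - G r" using r by (simp add: q_def field_simps)
  ultimately show thesis using that[OF D] by simp
qed

section \<open>The volume of slices of two convex bodies\<close>

lemma convex_body_slice:
  assumes "convex_body K" "convex_body L"
  shows "convex (K \<inter> (\<lambda>y. x - y) ` L)" "compact (K \<inter> (\<lambda>y. x - y) ` L)"
    "K \<inter> (\<lambda>y. x - y) ` L \<in> lmeasurable"
proof -
  have "(\<lambda>y. x - y) ` L = (\<lambda>y. x + y) ` (uminus ` L)" by (simp add: image_image)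
  then show "convex (K \<inter> (\<lambda>y. x - y) ` L)"
    using assms by (auto simp: convex_body_def intro!: convex_Int convex_translation convex_negations)
  show "compact (K \<inter> (\<lambda>y. x - y) ` L)"
    using assms by (auto simp: convex_body_def intro!: compact_Int compact_continuous_image continuous_intros)
  then show "K \<inter> (\<lambda>y. x - y) ` L \<in> lmeasurable" by (rule lmeasurable_compact)
qed

lemma conv_vol_nonneg: "0 \<le> conv_vol K L x"
  by (simp add: conv_vol_def)

text \<open>The volume of \<open>K\<close> bounds all slices, so the supremum is a genuine upper
  bound; outside \<open>K + L\<close> the slice is empty and its volume is 0.\<close>

lemma conv_vol_le_max:
  assumes K: "convex_body K" and L: "convex_body L"
  shows "conv_vol K L x \<le> max_conv_vol K L"
proof -
  have "K \<in> lmeasurable" using K by (auto simp: convex_body_def intro: lmeasurable_compact)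
  then have "conv_vol K L y \<le> measure lebesgue K" for y
    unfolding conv_vol_def using convex_body_slice(3)[OF K L]
    by (intro measure_mono_fmeasurable) auto
  then have bdd: "bdd_above (conv_vol K L ` (K + L))" by (intro bdd_aboveI[of _ "measure lebesgue K"]) blast
  have up: "conv_vol K L y \<le> max_conv_vol K L" if "y \<in> K + L" for y
    unfolding max_conv_vol_def using that bdd by (rule cSUP_upper)
  show ?thesis
  proof (cases "x \<in> K + L")
    case False
    then have "K \<inter> (\<lambda>y. x - y) ` L = {}" by (force simp: set_plus_def)
    then have "conv_vol K L x = 0" by (simp add: conv_vol_def)
    moreover obtain p q where "p \<in> K" "q \<in> L"
      using K L interior_subset unfolding convex_body_def by blast
    then have "p + q \<in> K + L" by auto
    then have "0 \<le> max_conv_vol K L" using up conv_vol_nonneg order_trans by blast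
    ultimately show ?thesis by simp
  qed (rule up)
qed

text \<open>For interior points \<open>p\<close> and \<open>q\<close>, the slice at
  \<open>p + q\<close> contains an open neighbourhood of \<open>p\<close>.\<close>

lemma max_conv_vol_pos:
  assumes K: "convex_body K" and L: "convex_body L"
  shows "0 < max_conv_vol K L"
proof -
  obtain p q where pq: "p \<in> interior K" "q \<in> interior L"
    using K L unfolding convex_body_def by blast
  let ?U = "interior K \<inter> (\<lambda>y. (p + q) - y) ` interior L"
  have eq: "(\<lambda>y. (p + q) - y) ` interior L = (\<lambda>y. (p + q) + y) ` (uminus ` interior L)"
    by (simp add: image_image)
  have "open ?U" unfolding eq by (intro open_Int open_translation open_negations open_interior)
  moreover have "bounded ?U"
    using K by (intro bounded_Int disjI1 bounded_interior compact_imp_bounded) (simp add: convex_body_def)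
  moreover have p: "p \<in> ?U" using pq by (auto intro!: image_eqI[of _ _ q])
  ultimately have "0 < measure lebesgue ?U" and U: "?U \<in> lmeasurable"
    using measure_open_pos[of ?U] lmeasurable_open[of ?U] by auto
  moreover have "measure lebesgue ?U \<le> conv_vol K L (p + q)"
    unfolding conv_vol_def
    by (intro measure_mono_fmeasurable convex_body_slice(3)[OF K L] fmeasurableD[OF U] Int_mono image_mono interior_subset)
  ultimately show ?thesis using conv_vol_le_max[OF K L, of "p + q"] by linarith
qed

text \<open>Convexity of \<open>K\<close> and \<open>L\<close> puts each convex combination of
  points from the slices at \<open>x\<close> and \<open>y\<close> into the slice at the combined
  point, as Brunn-Minkowski requires.\<close>

lemma root_conv_vol_concave:
  fixes K L :: "(real ^ 'n) set"
  assumes K: "convex_body K" and L: "convex_body L"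
    and x: "0 < conv_vol K L x" and y: "0 < conv_vol K L y" and t: "0 < t" "t < 1"
  shows "(1 - t) * root CARD('n) (conv_vol K L x) + t * root CARD('n) (conv_vol K L y)
       \<le> root CARD('n) (conv_vol K L ((1 - t) *\<^sub>R x + t *\<^sub>R y))"
proof -
  have sub: "(1 - t) *\<^sub>R p + t *\<^sub>R q \<in> K \<inter> (\<lambda>z. ((1 - t) *\<^sub>R x + t *\<^sub>R y) - z) ` L"
    if p: "p \<in> K \<inter> (\<lambda>z. x - z) ` L" and q: "q \<in> K \<inter> (\<lambda>z. y - z) ` L" for p q
  proof -
    obtain u v where uv: "u \<in> L" "p = x - u" "v \<in> L" "q = y - v" using p q by auto
    have "(1 - t) *\<^sub>R p + t *\<^sub>R q \<in> K" "(1 - t) *\<^sub>R u + t *\<^sub>R v \<in> L"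
      using p q uv K L t unfolding convex_body_def by (auto intro!: convexD)
    moreover have "(1 - t) *\<^sub>R p + t *\<^sub>R q = ((1 - t) *\<^sub>R x + t *\<^sub>R y) - ((1 - t) *\<^sub>R u + t *\<^sub>R v)"
      by (simp add: uv algebra_simps)
    ultimately show ?thesis by blast
  qed
  show ?thesis
    using Brunn_Minkowski_convex[OF convex_body_slice(1)[OF K L, of x] compact_imp_bounded[OF convex_body_slice(2)[OF K L]] _
        convex_body_slice(1)[OF K L, of y] compact_imp_bounded[OF convex_body_slice(2)[OF K L]] _
        t convex_body_slice(3)[OF K L] sub] x y
    unfolding conv_vol_def by (simp del: measure_completion)
qed

section \<open>The derivative estimate along a ray\<close>

theorem proposition4p1:
  fixes K L :: "(real ^ 'n) set" and \<theta> :: real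
  assumes "convex_body K" and "convex_body L"
    and "max_conv_vol K L = measure lebesgue (K \<inter> uminus ` L)"
    and "0 < \<theta>" and "\<theta> < 1"
  shows "theta_sum \<theta> K L \<subseteq>
    {x. x = 0 \<or>
        (\<exists>D. ((\<lambda>t. conv_vol K L (t *\<^sub>R (x /\<^sub>R norm x))) has_real_derivative D) (at_right 0) \<and>
             norm x * \<bar>D\<bar> \<le> real CARD('n) * (1 - \<theta> powr (1 / real CARD('n))) * max_conv_vol K L)}"
proof (intro subsetI CollectI disj_imp[THEN iffD2] impI)
  fix x assume "x \<in> theta_sum \<theta> K L" and x: "x \<noteq> 0"
  let ?n = "CARD('n)" and ?M = "max_conv_vol K L"
  define r where "r = norm x"
  define f where "f t = conv_vol K L (t *\<^sub>R (x /\<^sub>R norm x))" for t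
  define G where "G t = root ?n (f t)" for t
  have r: "0 < r" using x by (simp add: r_def)
  have M: "0 < ?M" using assms by (intro max_conv_vol_pos)
  \<comment> \<open>The hypothesis on \<open>K\<close> and \<open>L\<close> enters here: the ray
    starts at a maximum of the slice volume.\<close>
  have f0: "f 0 = ?M" using assms(3) by (simp add: f_def conv_vol_def)
  have "f r = conv_vol K L x" using x by (simp add: f_def r_def)
  then have fr: "\<theta> * ?M \<le> f r" using \<open>x \<in> theta_sum \<theta> K L\<close> by (simp add: theta_sum_def)
  have fle: "f t \<le> ?M" for t unfolding f_def using assms by (intro conv_vol_le_max)
  have step: "(1 - a / b) * G 0 + a / b * G b \<le> G a" if "0 < a" "a < b" "0 < f b" for a b
    using root_conv_vol_concave[OF assms(1,2), of 0 "b *\<^sub>R (x /\<^sub>R norm x)" "a / b"] that f0 M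
    by (simp add: G_def f_def)
  have Gr: "0 < G r" using fr M assms(4) by (simp add: G_def) (smt (verit) mult_pos_pos)
  have G0: "0 < G 0" using M f0 by (simp add: G_def)
  \<comment> \<open>Concavity of the root is available only between points of positive slice volume.
    The chord from 0 to \<open>r\<close> has positive ends, since \<open>\<theta> * ?M\<close> is
    positive, and this carries positivity to the whole interval.\<close>
  have fpos: "0 < f a" if "0 < a" "a \<le> r" for a
  proof (cases "a = r")
    case False
    then have "(1 - a / r) * G 0 + a / r * G r \<le> G a" using that Gr by (intro step) (auto simp: G_def)
    moreover have "0 < (1 - a / r) * G 0" "0 < a / r * G r" using False that G0 Gr by auto
    ultimately have "0 < G a" by linarith
    then show ?thesis by (simp add: G_def)
  qed (use Gr in \<open>simp add: G_def\<close>)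
  obtain D where D: "(G has_real_derivative D) (at_right 0)" "r * \<bar>D\<bar> \<le> G 0 - G r"
  proof (rule concave_right_derivative[OF r])
    show "(1 - a / b) * G 0 + a / b * G b \<le> G a" if "0 < a" "a < b" "b \<le> r" for a b
      using that fpos by (intro step) auto
    show "G t \<le> G 0" for t using fle f0 by (simp add: G_def)
  qed blast
  have fG: "f = (\<lambda>t. G t ^ ?n)" by (auto simp: G_def f_def conv_vol_nonneg)
  have "(f has_real_derivative real ?n * (D * G 0 ^ (?n - 1))) (at_right 0)"
    unfolding fG using DERIV_power[OF D(1), of ?n] by simp
  moreover have "r * \<bar>real ?n * (D * G 0 ^ (?n - 1))\<bar> \<le> real ?n * (1 - \<theta> powr (1 / real ?n)) * ?M"
  proof -
    \<comment> \<open>Membership in the theta-sum bounds the drop \<open>G 0 - G r\<close> by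
      \<open>(1 - \<theta> powr (1 / real ?n)) * G 0\<close>.\<close>
    have "root ?n (\<theta> * ?M) \<le> G r" using fr by (simp add: G_def)
    moreover have "root ?n (\<theta> * ?M) = \<theta> powr (1 / real ?n) * G 0"
      using assms(4) by (simp add: real_root_mult G_def f0 root_powr_inverse inverse_eq_divide)
    ultimately have "r * \<bar>D\<bar> \<le> (1 - \<theta> powr (1 / real ?n)) * G 0"
      using D(2) by (simp add: algebra_simps)
    \<comment> \<open>The factor \<open>real ?n * G 0 ^ (?n - 1)\<close> comes from the chain rule
      for the \<open>?n\<close>-th power; on the right it combines with \<open>G 0\<close> to
      \<open>real ?n * ?M\<close>.\<close>
    then have "real ?n * G 0 ^ (?n - 1) * (r * \<bar>D\<bar>) \<le> real ?n * G 0 ^ (?n - 1) * ((1 - \<theta> powr (1 / real ?n)) * G 0)"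
      using G0 by (intro mult_left_mono) auto
    also have "\<dots> = real ?n * (1 - \<theta> powr (1 / real ?n)) * (G 0 ^ (?n - 1) * G 0)" by simp
    also have "G 0 ^ (?n - 1) * G 0 = ?M"
      using f0 fG by (metis power_minus_mult zero_less_card_finite)
    finally show ?thesis using G0 by (simp add: abs_mult mult_ac)
  qed
  ultimately show "\<exists>D. ((\<lambda>t. conv_vol K L (t *\<^sub>R (x /\<^sub>R norm x))) has_real_derivative D) (at_right 0) \<and>
       norm x * \<bar>D\<bar> \<le> real ?n * (1 - \<theta> powr (1 / real ?n)) * ?M"
    unfolding f_def r_def by blast
qed

end
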